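(* Let $\mathcal{L}\in\{\mathrm{ML},\mathrm{ML}(\underline{\vee}),\mathrm{MDL},\mathrm{EMDL}\}$. The calculus $\mathbf{T}_{\mathcal{L}}$ is sound: if there is a closed tableau for an $\mathcal{L}$-formula $\varphi$ in $\mathbf{T}_{\mathcal{L}}$, then $\varphi$ is valid.
   Context: Syntax (negation normal form): $\mathrm{ML}$: $\varphi::=p\mid\neg p\mid(\varphi\wedge\varphi)\mid(\varphi\vee\varphi)\mid\Diamond\varphi\mid\Box\varphi$; $\mathrm{ML}(\underline{\vee})$ adds $(\varphi\,\underline{\vee}\,\varphi)$; $\mathrm{MDL}$ adds atoms ${=}(p_1,\dots,p_n,q)$; $\mathrm{EMDL}$ adds atoms ${=}(\varphi_1,\dots,\varphi_n,\psi)$ with $\varphi_i,\psi\in\mathrm{ML}$. For $\chi\in\mathrm{ML}$, $\chi^\bot$ is the negation normal form of $\neg\chi$; $\chi^\top:=\chi$. Team semantics: Kripke model $K=(W,R,V)$, $W\ne\emptyset$, $R\subseteq W\times W$, $V:\Phi\to\mathcal{P}(W)$; team $T\subseteq W$. $K,T\models p$ iff $T\subseteq V(p)$; $K,T\models\neg p$ iff $T\cap V(p)=\emptyset$; $\wedge$ conjunctively; $K,T\models\varphi\vee\psi$ iff $T=T_1\cup T_2$ with $K,T_1\models\varphi$, $K,T_2\models\psi$; $K,T\models\varphi\,\underline{\vee}\,\psi$ iff $K,T\models\varphi$ or $K,T\models\psi$; $K,T\models\Diamond\varphi$ iff $K,T'\models\varphi$ for some $T'$ such that each $w\in T$ has an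 $R$-successor in $T'$ and each $v\in T'$ an $R$-predecessor in $T$; $K,T\models\Box\varphi$ iff $K,R[T]\models\varphi$ ($R[T]$ = successors of $T$); $K,T\models{=}(\varphi_1,\dots,\varphi_n,\psi)$ iff any $w,v\in T$ agreeing on the truth of all $\varphi_i$ (on singleton teams) agree on $\psi$. Valid: true in all Kripke models and all teams. $\mathrm{vrank}(\varphi)$: number of $\underline{\vee}$ in $\varphi$, each dependence atom ${=}(\varphi_1,\dots,\varphi_n,\psi)$ first replaced by $\bigvee_{\vec a\in\{\bot,\top\}^n}\bigwedge\{\varphi_1^{a_1},\dots,\varphi_n^{a_n},(\psi\,\underline{\vee}\,\psi^\bot)\}$. Labeled tableaux: labels are finite subsets of $\mathbb{N}$; nodes carry labeled formulas $\alpha:\varphi$ or accessibility formulas $i\mathsf{R}j$. A tableau is a finitely branching tree built from the root by rule applications; a rule extends a branch containing its premises by alternatives (separated by $\mid$), each adding all its listed items; a labeled formula is never added to a branch already containing it, and ($\Box$) is never applied twice to the same labeled formula on a branch. Rules: (Prop) from $\{i_1,\dots,i_k\}:p$: $\{i_1\}:p\mid\dots\mid\{i_k\}:p$; ($\neg$Prop) likewise for $\neg p$; ($\wedge$) from $\alpha:(\varphi\wedge\psi)$: $\alpha:\varphi\mid\alpha:\psi$; ($\vee$) from $\alpha:(\varphi\vee\psi)$ and any $\beta\subseteq\alpha$: $\beta:\varphi\mid\alpha\setminus\beta:\psi$; ($\underline{\vee}$) from $\alpha:(\varphi\,\underline{\vee}\,\psi)$: add $\alpha:\varphi$ and $\alpha:\psi$;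 (Split) from $\alpha:{=}(\vec\chi,\theta)$: $\alpha_1:{=}(\vec\chi,\theta)\mid\dots\mid\alpha_k:{=}(\vec\chi,\theta)$, $\alpha_1,\dots,\alpha_k$ all 2-element subsets of $\alpha$; (PL dep) from $\{i_1,i_2\}:{=}(p_1,\dots,p_n,q)$: one alternative per $g:\{1,\dots,n\}\to\{\top,\bot\}$ adding $\{i_1\}:p_m^{g(m)},\{i_2\}:p_m^{g(m)}$ ($m\le n$), $\{i_1,i_2\}:q$, $\{i_1,i_2\}:\neg q$; (ML dep) from $\{i_1,i_2\}:{=}(\varphi_1,\dots,\varphi_n,\psi)$: one alternative per $h:\{1,\dots,n\}\to\{\top,\bot\}$ adding $\{i_1\}:\varphi_m^{h(m)},\{i_2\}:\varphi_m^{h(m)}$ ($m\le n$), $\{i_1,i_2\}:\psi$, $\{i_1,i_2\}:\psi^\bot$; ($\Diamond$) from $\{i_1,\dots,i_n\}:\Diamond\varphi$ and $i_1\mathsf{R}j_1,\dots,i_n\mathsf{R}j_n$: add $\{j_1,\dots,j_n\}:\varphi$; ($\Box$) from $\alpha:\Box\varphi$, with $t=2^{\mathrm{vrank}(\varphi)}$ and fresh distinct $i_1,\dots,i_t$: one alternative per $f:\{1,\dots,t\}\to\alpha$ adding $f(1)\mathsf{R}i_1,\dots,f(t)\mathsf{R}i_t$ and $\{i_1,\dots,i_t\}:\varphi$. Calculi: $\mathbf{T}_{\mathrm{ML}}$ = (Prop),($\neg$Prop),($\wedge$),($\vee$),($\Diamond$),($\Box$); $\mathbf{T}_{\mathrm{ML}(\underline{\vee})}$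 adds ($\underline{\vee}$); $\mathbf{T}_{\mathrm{MDL}}$ adds (Split),(PL dep); $\mathbf{T}_{\mathrm{EMDL}}$ adds (Split),(ML dep). A tableau for $\varphi$ in $\mathbf{T}_{\mathcal{L}}$ has root $\{1,\dots,2^{\mathrm{vrank}(\varphi)}\}:\varphi$. A branch is closed if it contains (1) $\alpha:p$ and $\alpha:\neg p$, or (2) $\emptyset:\psi$, or (3) $\{i\}:{=}(p_1,\dots,p_n,q)$, or (4) $\{i\}:{=}(\varphi_1,\dots,\varphi_n,\psi)$ with $\varphi_i,\psi\in\mathrm{ML}$; a tableau is closed if all branches are closed.
   Formalization: Closure condition (1) is required only at singleton labels, {i}:p and {i}:¬p; with arbitrary α the claim is false, since the non-valid formula p ⩒ ¬p (intuitionistic disjunction) would have a closed tableau after one step. *)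

theory Defs
  imports Main
begin

text \<open>One datatype hosts all four languages; \<open>formula_of\<close> below carves them out.
  \<open>IOr\<close> is the intuitionistic disjunction (underlined vee), and \<open>Dep [\<phi>\<^sub>1, \<dots>, \<phi>\<^sub>n] \<psi>\<close> is the
  dependence atom \<open>=(\<phi>\<^sub>1, \<dots>, \<phi>\<^sub>n, \<psi>)\<close>, where \<open>n = 0\<close> is allowed.\<close>

datatype 'p fm =
    Atom 'p
  | NAtom 'p
  | And "'p fm" "'p fm"
  | Or "'p fm" "'p fm"
  | IOr "'p fm" "'p fm"
  | Dia "'p fm"
  | Box "'p fm"
  | Dep "'p fm list" "'p fm"

datatype logic = L_ML | L_MLV | L_MDL | L_EMDL

fun formula_of :: "logic \<Rightarrow> 'p fm \<Rightarrow> bool" where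
  "formula_of L (Atom p) = True"
| "formula_of L (NAtom p) = True"
| "formula_of L (And \<phi> \<psi>) = (formula_of L \<phi> \<and> formula_of L \<psi>)"
| "formula_of L (Or \<phi> \<psi>) = (formula_of L \<phi> \<and> formula_of L \<psi>)"
| "formula_of L (IOr \<phi> \<psi>) = (L = L_MLV \<and> formula_of L \<phi> \<and> formula_of L \<psi>)"
| "formula_of L (Dia \<phi>) = formula_of L \<phi>"
| "formula_of L (Box \<phi>) = formula_of L \<phi>"
| "formula_of L (Dep \<phi>s \<psi>) =
     ((L = L_MDL \<and> (\<exists>ps q. \<phi>s = map Atom ps \<and> \<psi> = Atom q)) \<or>
      (L = L_EMDL \<and> (\<forall>\<chi>\<in>set \<phi>s. formula_of L_ML \<chi>) \<and> formula_of L_ML \<psi>))"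

text \<open>Negation normal form of the negation, for ML formulas only: on \<open>IOr\<close> and \<open>Dep\<close> it is
  deliberately left unspecified.\<close>

fun neg :: "'p fm \<Rightarrow> 'p fm" where
  "neg (Atom p) = NAtom p"
| "neg (NAtom p) = Atom p"
| "neg (And \<phi> \<psi>) = Or (neg \<phi>) (neg \<psi>)"
| "neg (Or \<phi> \<psi>) = And (neg \<phi>) (neg \<psi>)"
| "neg (Dia \<phi>) = Box (neg \<phi>)"
| "neg (Box \<phi>) = Dia (neg \<phi>)"

definition signed :: "'p fm \<Rightarrow> bool \<Rightarrow> 'p fm" where
  "signed \<chi> a = (if a then \<chi> else neg \<chi>)"


record ('w, 'p) kripke =
  worlds :: "'w set"
  rel :: "('w \<times> 'w) set"
  val :: "'p \<Rightarrow> 'w set"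

definition kripke_model :: "('w, 'p) kripke \<Rightarrow> bool" where
  "kripke_model K \<longleftrightarrow>
     worlds K \<noteq> {} \<and> rel K \<subseteq> worlds K \<times> worlds K \<and> (\<forall>p. val K p \<subseteq> worlds K)"

fun sat :: "('w, 'p) kripke \<Rightarrow> 'w set \<Rightarrow> 'p fm \<Rightarrow> bool" where
  "sat K T (Atom p) = (T \<subseteq> val K p)"
| "sat K T (NAtom p) = (T \<inter> val K p = {})"
| "sat K T (And \<phi> \<psi>) = (sat K T \<phi> \<and> sat K T \<psi>)"
| "sat K T (Or \<phi> \<psi>) = (\<exists>T1 T2. T = T1 \<union> T2 \<and> sat K T1 \<phi> \<and> sat K T2 \<psi>)"
| "sat K T (IOr \<phi> \<psi>) = (sat K T \<phi> \<or> sat K T \<psi>)"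
| "sat K T (Dia \<phi>) =
     (\<exists>T'. (\<forall>w\<in>T. \<exists>v\<in>T'. (w, v) \<in> rel K) \<and> (\<forall>v\<in>T'. \<exists>w\<in>T. (w, v) \<in> rel K) \<and> sat K T' \<phi>)"
| "sat K T (Box \<phi>) = sat K (rel K `` T) \<phi>"
| "sat K T (Dep \<phi>s \<psi>) =
     (\<forall>w\<in>T. \<forall>v\<in>T. (\<forall>\<chi>\<in>set \<phi>s. sat K {w} \<chi> \<longleftrightarrow> sat K {v} \<chi>) \<longrightarrow> (sat K {w} \<psi> \<longleftrightarrow> sat K {v} \<psi>))"

text \<open>The type of worlds is a parameter, since HOL cannot quantify over types inside a formula;
  a theorem with a free type variable here speaks about Kripke models of every type.\<close>

definition valid :: "'w itself \<Rightarrow> 'p fm \<Rightarrow> bool" where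
  "valid _ \<phi> \<longleftrightarrow>
     (\<forall>K :: ('w, 'p) kripke. kripke_model K \<longrightarrow> (\<forall>T. T \<subseteq> worlds K \<longrightarrow> sat K T \<phi>))"


fun big_or :: "'p fm list \<Rightarrow> 'p fm" where
  "big_or [\<phi>] = \<phi>"
| "big_or (\<phi> # \<psi> # \<phi>s) = Or \<phi> (big_or (\<psi> # \<phi>s))"

text \<open>In the last equation \<open>a\<close> ranges over all sign vectors of length \<open>n\<close>, so \<open>big_or\<close> is applied
  to a list of \<open>2^n > 0\<close> formulas; its value on the empty list is irrelevant.\<close>

fun elim_dep :: "'p fm \<Rightarrow> 'p fm" where
  "elim_dep (Atom p) = Atom p"
| "elim_dep (NAtom p) = NAtom p"
| "elim_dep (And \<phi> \<psi>) = And (elim_dep \<phi>) (elim_dep \<psi>)"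
| "elim_dep (Or \<phi> \<psi>) = Or (elim_dep \<phi>) (elim_dep \<psi>)"
| "elim_dep (IOr \<phi> \<psi>) = IOr (elim_dep \<phi>) (elim_dep \<psi>)"
| "elim_dep (Dia \<phi>) = Dia (elim_dep \<phi>)"
| "elim_dep (Box \<phi>) = Box (elim_dep \<phi>)"
| "elim_dep (Dep \<phi>s \<psi>) =
     big_or (map (\<lambda>a. foldr And (map2 signed \<phi>s a) (IOr \<psi> (neg \<psi>)))
                 (List.n_lists (length \<phi>s) [False, True]))"

fun count_ior :: "'p fm \<Rightarrow> nat" where
  "count_ior (Atom p) = 0"
| "count_ior (NAtom p) = 0"
| "count_ior (And \<phi> \<psi>) = count_ior \<phi> + count_ior \<psi>"
| "count_ior (Or \<phi> \<psi>) = count_ior \<phi> + count_ior \<psi>"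
| "count_ior (IOr \<phi> \<psi>) = Suc (count_ior \<phi> + count_ior \<psi>)"
| "count_ior (Dia \<phi>) = count_ior \<phi>"
| "count_ior (Box \<phi>) = count_ior \<phi>"
| "count_ior (Dep \<phi>s \<psi>) = 0"

definition vrank :: "'p fm \<Rightarrow> nat" where
  "vrank \<phi> = count_ior (elim_dep \<phi>)"


text \<open>\<open>Lab \<alpha> \<phi>\<close> is the labeled formula \<open>\<alpha>:\<phi>\<close>; \<open>Acc i j\<close> is the accessibility formula \<open>iRj\<close>.
  Labels are finite in every tableau: the root label is, and every rule preserves this.\<close>

datatype 'p item =
    Lab "nat set" "'p fm"
  | Acc nat nat

fun item_indices :: "'p item \<Rightarrow> nat set" where
  "item_indices (Lab \<alpha> \<phi>) = \<alpha>"
| "item_indices (Acc i j) = {i, j}"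

definition dep_alternatives ::
    "nat \<Rightarrow> nat \<Rightarrow> 'p fm list \<Rightarrow> 'p fm \<Rightarrow> 'p item set set" where
  "dep_alternatives i1 i2 \<phi>s \<psi> =
     {{Lab {i} (signed (\<phi>s ! m) (g m)) | i m. i \<in> {i1, i2} \<and> m < length \<phi>s}
        \<union> {Lab {i1, i2} \<psi>, Lab {i1, i2} (neg \<psi>)} | g :: nat \<Rightarrow> bool. True}"

text \<open>\<open>rule L X \<alpha> \<phi> As\<close>: a rule of the calculus for \<open>L\<close> applies to the labeled formula \<open>\<alpha>:\<phi>\<close> on a
  branch whose set of items is \<open>X\<close>, with the set \<open>As\<close> of alternatives, each being the set of
  items it lists. Reading \<open>\<alpha>:\<phi>\<close> as "the team named by \<open>\<alpha>\<close> falsifies \<open>\<phi>\<close>" explains the shape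
  of the rules.\<close>

inductive rule :: "logic \<Rightarrow> 'p item set \<Rightarrow> nat set \<Rightarrow> 'p fm \<Rightarrow> 'p item set set \<Rightarrow> bool"
  for L :: logic and X :: "'p item set" where
  atom: "Lab \<alpha> (Atom p) \<in> X \<Longrightarrow>
    rule L X \<alpha> (Atom p) {{Lab {i} (Atom p)} | i. i \<in> \<alpha>}"
| natom: "Lab \<alpha> (NAtom p) \<in> X \<Longrightarrow>
    rule L X \<alpha> (NAtom p) {{Lab {i} (NAtom p)} | i. i \<in> \<alpha>}"
| conj: "Lab \<alpha> (And \<phi> \<psi>) \<in> X \<Longrightarrow>
    rule L X \<alpha> (And \<phi> \<psi>) {{Lab \<alpha> \<phi>}, {Lab \<alpha> \<psi>}}"
| disj: "Lab \<alpha> (Or \<phi> \<psi>) \<in> X \<Longrightarrow> \<beta> \<subseteq> \<alpha> \<Longrightarrow>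
    rule L X \<alpha> (Or \<phi> \<psi>) {{Lab \<beta> \<phi>}, {Lab (\<alpha> - \<beta>) \<psi>}}"
| dia: "Lab \<alpha> (Dia \<phi>) \<in> X \<Longrightarrow> \<forall>i\<in>\<alpha>. Acc i (s i) \<in> X \<Longrightarrow>
    rule L X \<alpha> (Dia \<phi>) {{Lab (s ` \<alpha>) \<phi>}}"
| box: "Lab \<alpha> (Box \<phi>) \<in> X \<Longrightarrow> (t::nat) = 2 ^ vrank \<phi> \<Longrightarrow>
    inj_on j {1..t} \<Longrightarrow> \<forall>x\<in>X. j ` {1..t} \<inter> item_indices x = {} \<Longrightarrow>
    rule L X \<alpha> (Box \<phi>)
      {{Acc (f m) (j m) | m. m \<in> {1..t}} \<union> {Lab (j ` {1..t}) \<phi>} | f. f ` {1..t} \<subseteq> \<alpha>}"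
| ior: "L = L_MLV \<Longrightarrow> Lab \<alpha> (IOr \<phi> \<psi>) \<in> X \<Longrightarrow>
    rule L X \<alpha> (IOr \<phi> \<psi>) {{Lab \<alpha> \<phi>, Lab \<alpha> \<psi>}}"
| split: "L \<in> {L_MDL, L_EMDL} \<Longrightarrow> Lab \<alpha> (Dep \<phi>s \<psi>) \<in> X \<Longrightarrow>
    rule L X \<alpha> (Dep \<phi>s \<psi>) {{Lab \<beta> (Dep \<phi>s \<psi>)} | \<beta>. \<beta> \<subseteq> \<alpha> \<and> card \<beta> = 2}"
| pl_dep: "L = L_MDL \<Longrightarrow> Lab {i1, i2} (Dep (map Atom ps) (Atom q)) \<in> X \<Longrightarrow>
    rule L X {i1, i2} (Dep (map Atom ps) (Atom q))
      (dep_alternatives i1 i2 (map Atom ps) (Atom q))"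
| ml_dep: "L = L_EMDL \<Longrightarrow> Lab {i1, i2} (Dep \<phi>s \<psi>) \<in> X \<Longrightarrow>
    \<forall>\<chi>\<in>set \<phi>s. formula_of L_ML \<chi> \<Longrightarrow> formula_of L_ML \<psi> \<Longrightarrow>
    rule L X {i1, i2} (Dep \<phi>s \<psi>) (dep_alternatives i1 i2 \<phi>s \<psi>)"

text \<open>A node stores all items that one alternative of a rule application adds (instead of a
  chain of nodes carrying one item each). The set is empty if all of them are already on the
  branch; the alternative is still represented by its own child.\<close>

datatype 'p tableau = Node (items: "'p item set") (children: "'p tableau list")

text \<open>\<open>expands L B D t\<close>: \<open>t\<close> is a legal subtableau below ancestors with item set \<open>B\<close>, where \<open>D\<close>
  collects the labeled formulas to which a rule was already applied on the branch. \<open>D\<close> is only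
  consulted to prevent a second application of the box rule to the same labeled formula, and
  \<open>A - X\<close> ensures that nothing is added to a branch already containing it. A rule
  application without alternatives leaves the branch as it is.\<close>

inductive expands ::
    "logic \<Rightarrow> 'p item set \<Rightarrow> 'p item set \<Rightarrow> 'p tableau \<Rightarrow> bool" for L :: logic where
  leaf: "expands L B D (Node N [])"
| step: "X = B \<union> N \<Longrightarrow> rule L X \<alpha> \<phi> As \<Longrightarrow>
    (\<exists>\<psi>. \<phi> = Box \<psi>) \<longrightarrow> Lab \<alpha> \<phi> \<notin> D \<Longrightarrow>
    items ` set ts = (\<lambda>A. A - X) ` As \<Longrightarrow>
    \<forall>t\<in>set ts. expands L X (insert (Lab \<alpha> \<phi>) D) t \<Longrightarrow>
    expands L B D (Node N ts)"

definition tableau_for :: "logic \<Rightarrow> 'p fm \<Rightarrow> 'p tableau \<Rightarrow> bool" where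
  "tableau_for L \<phi> t \<longleftrightarrow> items t = {Lab {1..2 ^ vrank \<phi>} \<phi>} \<and> expands L {} {} t"

fun branches :: "'p tableau \<Rightarrow> 'p item set set" where
  "branches (Node N ts) =
     (if ts = [] then {N} else (\<Union>t\<in>set ts. (\<lambda>b. N \<union> b) ` branches t))"

text \<open>Contradictory literals close a branch only at a singleton label: a team with several worlds
  may falsify both \<open>p\<close> and \<open>\<not>p\<close>. The last rule covers propositional dependence atoms as well,
  proposition symbols being ML formulas.\<close>

inductive closed_branch :: "'p item set \<Rightarrow> bool" for b :: "'p item set" where
  clash: "Lab {i} (Atom p) \<in> b \<Longrightarrow> Lab {i} (NAtom p) \<in> b \<Longrightarrow> closed_branch b"
| empty: "Lab {} \<psi> \<in> b \<Longrightarrow> closed_branch b"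
| dep: "Lab {i} (Dep \<phi>s \<psi>) \<in> b \<Longrightarrow>
    \<forall>\<chi>\<in>set \<phi>s. formula_of L_ML \<chi> \<Longrightarrow> formula_of L_ML \<psi> \<Longrightarrow> closed_branch b"

definition closed_tableau :: "'p tableau \<Rightarrow> bool" where
  "closed_tableau t \<longleftrightarrow> (\<forall>b\<in>branches t. closed_branch b)"

end

theory Submission
  imports Defs
begin

text \<open>Fix a Kripke model and read \<open>\<alpha>:\<phi>\<close> as "the team of the worlds named by \<open>\<alpha>\<close> falsifies \<open>\<phi>\<close>".
  If a branch can be realized in this sense by some naming of worlds, then so can one of its
  extensions under every rule, while a closed branch cannot be realized.

  The rule for \<open>\<box>\<close> and the choice of the root label need that a team falsifying \<open>\<phi>\<close> has a subteam
  of size at most \<open>2^vrank \<phi>\<close> that falsifies \<open>\<phi>\<close>. This holds because the teams satisfying \<open>\<phi>\<close> are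
  exactly the subsets of the members of a family of at most \<open>2^vrank \<phi>\<close> sets of worlds: from the
  falsifying team it suffices to choose, for each member, one world outside of it.\<close>

section \<open>Flatness and negation for ML formulas\<close>

text \<open>Meaningful for ML formulas only: the values on \<open>IOr\<close> and \<open>Dep\<close> are arbitrary.\<close>

primrec ext :: "('w, 'p) kripke \<Rightarrow> 'p fm \<Rightarrow> 'w set" where
  "ext K (Atom p) = val K p"
| "ext K (NAtom p) = - val K p"
| "ext K (And \<phi> \<psi>) = ext K \<phi> \<inter> ext K \<psi>"
| "ext K (Or \<phi> \<psi>) = ext K \<phi> \<union> ext K \<psi>"
| "ext K (IOr \<phi> \<psi>) = ext K \<phi> \<union> ext K \<psi>"
| "ext K (Dia \<phi>) = {w. \<exists>v \<in> ext K \<phi>. (w, v) \<in> rel K}"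
| "ext K (Box \<phi>) = {w. \<forall>v. (w, v) \<in> rel K \<longrightarrow> v \<in> ext K \<phi>}"
| "ext K (Dep \<phi>s \<psi>) = UNIV"

text \<open>The parts of \<open>T\<close> inside \<open>P\<close> and inside \<open>Q\<close>
  witness the split. Besides flatness, this serves the disjunction case of the generating
  families.\<close>

lemma split_team_iff:
  "(\<exists>T1 T2. T = T1 \<union> T2 \<and> T1 \<subseteq> P \<and> T2 \<subseteq> Q) \<longleftrightarrow> T \<subseteq> P \<union> Q"
proof
  assume "T \<subseteq> P \<union> Q"
  then have "T = T \<inter> P \<union> T \<inter> Q" by blast
  then show "\<exists>T1 T2. T = T1 \<union> T2 \<and> T1 \<subseteq> P \<and> T2 \<subseteq> Q"
    by (meson inf_le2)
qed blast

lemma successor_team_iff: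
  "(\<exists>T'. (\<forall>w\<in>T. \<exists>v\<in>T'. (w, v) \<in> R) \<and> (\<forall>v\<in>T'. \<exists>w\<in>T. (w, v) \<in> R) \<and> T' \<subseteq> P)
     \<longleftrightarrow> T \<subseteq> {w. \<exists>v\<in>P. (w, v) \<in> R}"
proof
  assume "T \<subseteq> {w. \<exists>v\<in>P. (w, v) \<in> R}"
  then show "\<exists>T'. (\<forall>w\<in>T. \<exists>v\<in>T'. (w, v) \<in> R) \<and> (\<forall>v\<in>T'. \<exists>w\<in>T. (w, v) \<in> R) \<and> T' \<subseteq> P"
    by (intro exI[of _ "P \<inter> R `` T"]) blast
qed blast

text \<open>This is flatness of ML; \<open>T\<close> is generalized since \<open>Or\<close>,
  \<open>Dia\<close> and \<open>Box\<close> evaluate their arguments on other teams.\<close>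

lemma sat_ML_iff: "formula_of L_ML \<phi> \<Longrightarrow> sat K T \<phi> \<longleftrightarrow> T \<subseteq> ext K \<phi>"
proof (induction \<phi> arbitrary: T)
  case (Or \<phi> \<psi>)
  then show ?case by (simp add: split_team_iff)
next
  case (Dia \<phi>)
  then show ?case by (simp add: successor_team_iff)
qed auto

lemma ext_neg: "formula_of L_ML \<phi> \<Longrightarrow> ext K (neg \<phi>) = - ext K \<phi>"
  by (induction \<phi>) auto

lemma ext_signed: "formula_of L_ML \<phi> \<Longrightarrow> ext K (signed \<phi> a) = (if a then ext K \<phi> else - ext K \<phi>)"
  by (simp add: signed_def ext_neg)

lemma formula_of_neg: "formula_of L_ML \<phi> \<Longrightarrow> formula_of L_ML (neg \<phi>)"
  by (induction \<phi>) auto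

lemma formula_of_signed: "formula_of L_ML \<phi> \<Longrightarrow> formula_of L_ML (signed \<phi> a)"
  by (simp add: signed_def formula_of_neg)

lemma formula_of_ML_mono: "formula_of L_ML \<phi> \<Longrightarrow> formula_of L \<phi>"
  by (induction \<phi>) auto

lemma formula_of_DepD:
  "formula_of L (Dep \<phi>s \<psi>) \<Longrightarrow> (\<forall>\<chi>\<in>set \<phi>s. formula_of L_ML \<chi>) \<and> formula_of L_ML \<psi>"
  by auto

section \<open>The rank of a dependence atom\<close>

lemma count_ior_ML: "formula_of L_ML \<phi> \<Longrightarrow> count_ior \<phi> = 0"
  by (induction \<phi>) auto

lemma count_ior_big_or: "\<phi>s \<noteq> [] \<Longrightarrow> count_ior (big_or \<phi>s) = sum_list (map count_ior \<phi>s)"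
  by (induction \<phi>s rule: big_or.induct) auto

lemma count_ior_foldr_And:
  "count_ior (foldr And \<phi>s \<psi>) = sum_list (map count_ior \<phi>s) + count_ior \<psi>"
  by (induction \<phi>s) auto

text \<open>Each sign vector yields one disjunct, and each disjunct contains exactly one
  \<open>IOr\<close>, as the ML formulas in it contain none.\<close>

lemma vrank_Dep:
  assumes "\<forall>\<chi>\<in>set \<phi>s. formula_of L_ML \<chi>" and "formula_of L_ML \<psi>"
  shows "vrank (Dep \<phi>s \<psi>) = 2 ^ length \<phi>s"
proof -
  let ?vs = "List.n_lists (length \<phi>s) [False, True]"
  let ?d = "\<lambda>a. foldr And (map2 signed \<phi>s a) (IOr \<psi> (neg \<psi>))"
  have "count_ior (?d a) = 1" for a
  proof -
    have "\<forall>x\<in>set (map2 signed \<phi>s a). count_ior x = 0"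
      using assms(1) by (auto dest!: set_zip_leftD simp: count_ior_ML formula_of_signed)
    then have "sum_list (map count_ior (map2 signed \<phi>s a)) = 0"
      by (metis (no_types, lifting) map_eq_conv sum_list_0)
    then show ?thesis
      using assms(2) by (simp add: count_ior_foldr_And count_ior_ML formula_of_neg)
  qed
  moreover have "length ?vs = 2 ^ length \<phi>s"
    by (simp add: length_n_lists numeral_2_eq_2)
  moreover from this have "?vs \<noteq> []"
    by auto
  ultimately show ?thesis
    by (simp add: vrank_def count_ior_big_or comp_def sum_list_triv)
qed

section \<open>Generating families and small falsifying teams\<close>

lemma card_image_prod_le:
  assumes "finite F" "finite G" "card F \<le> m" "card G \<le> n"
  shows "card ((\<lambda>(P, Q). h P Q) ` (F \<times> G)) \<le> m * n"
proof -
  have "card ((\<lambda>(P, Q). h P Q) ` (F \<times> G)) \<le> card F * card G"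
    using card_image_le[of "F \<times> G" "\<lambda>(P, Q). h P Q"] assms(1,2)
    by (simp add: card_cartesian_product)
  also have "\<dots> \<le> m * n"
    using assms(3,4) by (rule mult_le_mono)
  finally show ?thesis .
qed

text \<open>\<open>And\<close> and \<open>Or\<close> take pairwise intersections and unions, so
  exponents add; \<open>IOr\<close> joins the two families; the modalities take preimages. A
  dependence atom gets one set for each Boolean function of the truth values of
  \<open>\<phi>s\<close>.\<close>

lemma sat_generating_family:
  assumes "formula_of L \<phi>"
  shows "\<exists>F. finite F \<and> F \<noteq> {} \<and> card F \<le> 2 ^ vrank \<phi> \<and> (\<forall>T. sat K T \<phi> \<longleftrightarrow> (\<exists>P\<in>F. T \<subseteq> P))"
  using assms
proof (induction \<phi>)
  case (Atom p)
  show ?case by (intro exI[of _ "{val K p}"]) auto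
next
  case (NAtom p)
  show ?case by (intro exI[of _ "{- val K p}"]) auto
next
  case (And \<phi> \<psi>)
  then obtain F G where
    F: "finite F" "F \<noteq> {}" "card F \<le> 2 ^ vrank \<phi>" "\<And>T. sat K T \<phi> \<longleftrightarrow> (\<exists>P\<in>F. T \<subseteq> P)" and
    G: "finite G" "G \<noteq> {}" "card G \<le> 2 ^ vrank \<psi>" "\<And>T. sat K T \<psi> \<longleftrightarrow> (\<exists>P\<in>G. T \<subseteq> P)"
    by auto
  have "card ((\<lambda>(P, Q). P \<inter> Q) ` (F \<times> G)) \<le> 2 ^ vrank (And \<phi> \<psi>)"
    using card_image_prod_le[OF F(1) G(1) F(3) G(3)] by (simp add: vrank_def power_add)
  then show ?case using F G
    by (intro exI[of _ "(\<lambda>(P, Q). P \<inter> Q) ` (F \<times> G)"]) auto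
next
  case (Or \<phi> \<psi>)
  then obtain F G where
    F: "finite F" "F \<noteq> {}" "card F \<le> 2 ^ vrank \<phi>" "\<And>T. sat K T \<phi> \<longleftrightarrow> (\<exists>P\<in>F. T \<subseteq> P)" and
    G: "finite G" "G \<noteq> {}" "card G \<le> 2 ^ vrank \<psi>" "\<And>T. sat K T \<psi> \<longleftrightarrow> (\<exists>P\<in>G. T \<subseteq> P)"
    by auto
  have card: "card ((\<lambda>(P, Q). P \<union> Q) ` (F \<times> G)) \<le> 2 ^ vrank (Or \<phi> \<psi>)"
    using card_image_prod_le[OF F(1) G(1) F(3) G(3)] by (simp add: vrank_def power_add)
  have "sat K T (Or \<phi> \<psi>) \<longleftrightarrow> (\<exists>P\<in>F. \<exists>Q\<in>G. T \<subseteq> P \<union> Q)" for T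
    unfolding split_team_iff[symmetric] by (simp add: F(4) G(4)) blast
  then show ?case using F(1,2) G(1,2) card
    by (intro exI[of _ "(\<lambda>(P, Q). P \<union> Q) ` (F \<times> G)"]) auto
next
  case (IOr \<phi> \<psi>)
  have "formula_of L \<phi>" "formula_of L \<psi>"
    using IOr.prems by auto
  obtain F where F: "finite F" "F \<noteq> {}" "card F \<le> 2 ^ vrank \<phi>"
      "\<And>T. sat K T \<phi> \<longleftrightarrow> (\<exists>P\<in>F. T \<subseteq> P)"
    using IOr.IH(1)[OF \<open>formula_of L \<phi>\<close>] by metis
  obtain G where G: "finite G" "G \<noteq> {}" "card G \<le> 2 ^ vrank \<psi>"
      "\<And>T. sat K T \<psi> \<longleftrightarrow> (\<exists>P\<in>G. T \<subseteq> P)"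
    using IOr.IH(2)[OF \<open>formula_of L \<psi>\<close>] by metis
  have "card (F \<union> G) \<le> 2 ^ vrank \<phi> + 2 ^ vrank \<psi>"
    using card_Un_le[of F G] F(3) G(3) by linarith
  \<comment> \<open>Both summands are bounded by the same power; the resulting factor 2 pays for the
    \<open>IOr\<close> itself.\<close>
  also have "\<dots> \<le> 2 ^ (vrank \<phi> + vrank \<psi>) + 2 ^ (vrank \<phi> + vrank \<psi>)"
    by (intro add_mono power_increasing) auto
  also have "\<dots> = 2 ^ vrank (IOr \<phi> \<psi>)"
    by (simp add: vrank_def)
  finally show ?case using F G
    by (intro exI[of _ "F \<union> G"]) auto
next
  case (Dia \<phi>)
  then obtain F where
    F: "finite F" "F \<noteq> {}" "card F \<le> 2 ^ vrank \<phi>" "\<And>T. sat K T \<phi> \<longleftrightarrow> (\<exists>P\<in>F. T \<subseteq> P)"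
    by auto
  let ?h = "\<lambda>P. {w. \<exists>v\<in>P. (w, v) \<in> rel K}"
  have "sat K T (Dia \<phi>) \<longleftrightarrow> (\<exists>P\<in>F. T \<subseteq> ?h P)" for T
    unfolding successor_team_iff[symmetric] by (simp add: F(4)) blast
  moreover have "card (?h ` F) \<le> 2 ^ vrank (Dia \<phi>)"
    using card_image_le[OF F(1), of ?h] F(3) by (simp add: vrank_def)
  ultimately show ?case using F(1,2)
    by (intro exI[of _ "?h ` F"]) simp
next
  case (Box \<phi>)
  then obtain F where
    F: "finite F" "F \<noteq> {}" "card F \<le> 2 ^ vrank \<phi>" "\<And>T. sat K T \<phi> \<longleftrightarrow> (\<exists>P\<in>F. T \<subseteq> P)"
    by auto
  let ?h = "\<lambda>P. {w. \<forall>v. (w, v) \<in> rel K \<longrightarrow> v \<in> P}"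
  have "rel K `` T \<subseteq> P \<longleftrightarrow> T \<subseteq> ?h P" for T P
    by blast
  then have "sat K T (Box \<phi>) \<longleftrightarrow> (\<exists>P\<in>F. T \<subseteq> ?h P)" for T
    by (simp add: F(4))
  moreover have "card (?h ` F) \<le> 2 ^ vrank (Box \<phi>)"
    using card_image_le[OF F(1), of ?h] F(3) by (simp add: vrank_def)
  ultimately show ?case using F(1,2)
    by (intro exI[of _ "?h ` F"]) simp
next
  case (Dep \<phi>s \<psi>)
  have is_ml: "\<forall>\<chi>\<in>set \<phi>s. formula_of L_ML \<chi>" "formula_of L_ML \<psi>"
    using formula_of_DepD[OF Dep.prems] by blast+
  \<comment> \<open>\<open>?vec w\<close> lists the truth values of \<open>\<phi>s\<close> at
    \<open>w\<close>. A set \<open>C\<close> of such vectors encodes a Boolean function, and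
    \<open>?h C\<close> collects the worlds where it gives the truth value of
    \<open>\<psi>\<close>.\<close>
  let ?vec = "\<lambda>w. map (\<lambda>\<chi>. w \<in> ext K \<chi>) \<phi>s"
  let ?S = "set (List.n_lists (length \<phi>s) [False, True])"
  let ?h = "\<lambda>C. {w. w \<in> ext K \<psi> \<longleftrightarrow> ?vec w \<in> C}"
  have vec: "?vec w \<in> ?S" for w
    by (auto simp: set_n_lists)
  have "card ?S \<le> 2 ^ length \<phi>s"
    by (rule order_trans[OF card_length]) (simp add: length_n_lists numeral_2_eq_2)
  then have "card (Pow ?S) \<le> 2 ^ vrank (Dep \<phi>s \<psi>)"
    using vrank_Dep[OF is_ml] by (simp add: card_Pow)
  then have "card (?h ` Pow ?S) \<le> 2 ^ vrank (Dep \<phi>s \<psi>)"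
    by (meson card_image_le finite_Pow_iff finite_set order_trans)
  moreover have "sat K T (Dep \<phi>s \<psi>) \<longleftrightarrow> (\<exists>P\<in>?h ` Pow ?S. T \<subseteq> P)" for T
  proof -
    have "sat K T (Dep \<phi>s \<psi>) \<longleftrightarrow>
        (\<forall>w\<in>T. \<forall>v\<in>T. ?vec w = ?vec v \<longrightarrow> (w \<in> ext K \<psi> \<longleftrightarrow> v \<in> ext K \<psi>))"
      using is_ml by (simp add: sat_ML_iff)
    also have "\<dots> \<longleftrightarrow> (\<exists>C\<in>Pow ?S. T \<subseteq> ?h C)"
    proof
      assume *: "\<forall>w\<in>T. \<forall>v\<in>T. ?vec w = ?vec v \<longrightarrow> (w \<in> ext K \<psi> \<longleftrightarrow> v \<in> ext K \<psi>)"
      \<comment> \<open>The function is true on the vectors of those worlds of \<open>T\<close> that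
        satisfy \<open>\<psi>\<close>; by dependence, every world of \<open>T\<close> with such a
        vector satisfies \<open>\<psi>\<close>.\<close>
      have "T \<subseteq> ?h (?vec ` (T \<inter> ext K \<psi>))"
        using * by blast
      moreover have "?vec ` (T \<inter> ext K \<psi>) \<in> Pow ?S"
        using vec by blast
      ultimately show "\<exists>C\<in>Pow ?S. T \<subseteq> ?h C"
        by blast
    next
      assume "\<exists>C\<in>Pow ?S. T \<subseteq> ?h C"
      then obtain C where "T \<subseteq> ?h C" by blast
      then have "w \<in> ext K \<psi> \<longleftrightarrow> ?vec w \<in> C" if "w \<in> T" for w
        using that by blast
      then show "\<forall>w\<in>T. \<forall>v\<in>T. ?vec w = ?vec v \<longrightarrow> (w \<in> ext K \<psi> \<longleftrightarrow> v \<in> ext K \<psi>)"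
        by metis
    qed
    finally show ?thesis by simp
  qed
  ultimately show ?case
    by (intro exI[of _ "?h ` Pow ?S"]) auto
qed

text \<open>The generating family is nonempty, and the empty team lies below any member.\<close>

lemma sat_empty_team: "formula_of L \<phi> \<Longrightarrow> sat K {} \<phi>"
  using sat_generating_family[of L \<phi> K] by auto

text \<open>The subteam is the image of an index set \<open>J\<close>, possibly with repetitions,
  because the root label and the labels created by the box rule have exactly this many
  names.\<close>

lemma falsifying_subteam:
  assumes "formula_of L \<phi>" and "\<not> sat K T \<phi>" and "card J = 2 ^ vrank \<phi>"
  shows "\<exists>h. h ` J \<subseteq> T \<and> \<not> sat K (h ` J) \<phi>"
proof -
  obtain F where F: "finite F" "F \<noteq> {}" "card F \<le> 2 ^ vrank \<phi>"
      "\<And>T. sat K T \<phi> \<longleftrightarrow> (\<exists>P\<in>F. T \<subseteq> P)"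
    using sat_generating_family[OF assms(1)] by metis
  have "finite J"
    using assms(3) by (intro card_ge_0_finite) simp
  then obtain g where g: "g ` F \<subseteq> J" "inj_on g F"
    using card_le_inj[OF F(1)] F(3) assms(3) by metis
  have "\<forall>P\<in>F. \<exists>w. w \<in> T - P"
    using assms(2) F(4) by blast
  then obtain w where w: "\<And>P. P \<in> F \<Longrightarrow> w P \<in> T - P"
    by metis
  \<comment> \<open>\<open>P0\<close> supplies a default for the names not hit by \<open>g\<close>:
    these must denote worlds of \<open>T\<close> too.\<close>
  obtain P0 where "P0 \<in> F"
    using F(2) by blast
  define h where "h x = w (if x \<in> g ` F then inv_into F g x else P0)" for x
  have "(if x \<in> g ` F then inv_into F g x else P0) \<in> F" for x
    using \<open>P0 \<in> F\<close> by (simp add: inv_into_into)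
  then have "h x \<in> T" for x
    using w unfolding h_def by blast
  \<comment> \<open>The name \<open>g P\<close> denotes a world outside \<open>P\<close>, so no
    member of \<open>F\<close> covers the image.\<close>
  moreover have "h (g P) \<notin> P" if "P \<in> F" for P
    using w[OF that] that g(2) by (simp add: h_def)
  then have "\<not> sat K (h ` J) \<phi>"
    unfolding F(4) using g(1) by blast
  ultimately show ?thesis by (intro exI[of _ h]) blast
qed

section \<open>Realizing the items of a branch by naming worlds\<close>

text \<open>Membership in the language belongs to the invariant: the subteam bound and the treatment
  of dependence atoms rely on it.\<close>

fun realizes_item :: "logic \<Rightarrow> ('w, 'p) kripke \<Rightarrow> (nat \<Rightarrow> 'w) \<Rightarrow> 'p item \<Rightarrow> bool" where
  "realizes_item L K I (Lab \<alpha> \<phi>) \<longleftrightarrow> formula_of L \<phi> \<and> \<not> sat K (I ` \<alpha>) \<phi>"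
| "realizes_item L K I (Acc i j) \<longleftrightarrow> (I i, I j) \<in> rel K"

definition realizes :: "logic \<Rightarrow> ('w, 'p) kripke \<Rightarrow> (nat \<Rightarrow> 'w) \<Rightarrow> 'p item set \<Rightarrow> bool" where
  "realizes L K I X \<longleftrightarrow> (\<forall>x\<in>X. realizes_item L K I x)"

lemma realizes_Un [simp]: "realizes L K I (X \<union> Y) \<longleftrightarrow> realizes L K I X \<and> realizes L K I Y"
  by (auto simp: realizes_def)

lemma realizes_insert [simp]:
  "realizes L K I (insert x X) \<longleftrightarrow> realizes_item L K I x \<and> realizes L K I X"
  by (auto simp: realizes_def)

lemma realizes_empty [simp]: "realizes L K I {}"
  by (simp add: realizes_def)

lemma realizes_item_cong:
  "\<forall>i\<in>item_indices x. I i = I' i \<Longrightarrow> realizes_item L K I x \<longleftrightarrow> realizes_item L K I' x"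
  by (cases x) (auto cong: image_cong_simp)

lemma realizes_dep_alternative:
  assumes "formula_of L (Dep \<phi>s \<psi>)" and "\<not> sat K (I ` {i1, i2}) (Dep \<phi>s \<psi>)"
  shows "\<exists>A\<in>dep_alternatives i1 i2 \<phi>s \<psi>. realizes L K I A"
proof -
  have is_ml: "\<forall>\<chi>\<in>set \<phi>s. formula_of L_ML \<chi>" "formula_of L_ML \<psi>"
    using formula_of_DepD[OF assms(1)] by blast+
  have agree: "\<forall>\<chi>\<in>set \<phi>s. I i1 \<in> ext K \<chi> \<longleftrightarrow> I i2 \<in> ext K \<chi>"
    and differ: "I i1 \<in> ext K \<psi> \<longleftrightarrow> I i2 \<notin> ext K \<psi>"
    using assms(2) is_ml by (auto simp: sat_ML_iff)
  \<comment> \<open>The sign is opposite to the common truth value, so that both worlds falsify the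
    signed formula.\<close>
  define g where "g m \<longleftrightarrow> I i1 \<notin> ext K (\<phi>s ! m)" for m
  let ?A = "{Lab {i} (signed (\<phi>s ! m) (g m)) | i m. i \<in> {i1, i2} \<and> m < length \<phi>s}
        \<union> {Lab {i1, i2} \<psi>, Lab {i1, i2} (neg \<psi>)}"
  have "realizes_item L K I (Lab {i} (signed (\<phi>s ! m) (g m)))"
    if "i \<in> {i1, i2}" "m < length \<phi>s" for i m
  proof -
    have "\<phi>s ! m \<in> set \<phi>s"
      using that(2) by simp
    then show ?thesis
      using that(1) agree is_ml(1)
      by (auto simp: sat_ML_iff formula_of_signed ext_signed formula_of_ML_mono g_def)
  qed
  then have "\<forall>x\<in>{Lab {i} (signed (\<phi>s ! m) (g m)) | i m. i \<in> {i1, i2} \<and> m < length \<phi>s}.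
      realizes_item L K I x"
    by blast
  moreover have "realizes_item L K I (Lab {i1, i2} \<psi>)" "realizes_item L K I (Lab {i1, i2} (neg \<psi>))"
    using is_ml(2) differ by (auto simp: sat_ML_iff formula_of_neg ext_neg formula_of_ML_mono)
  ultimately have "realizes L K I ?A"
    unfolding realizes_def by blast
  then show ?thesis
    unfolding dep_alternatives_def by blast
qed

text \<open>Only the box rule changes the naming. In particular, a rule application without
  alternatives is impossible on a realized branch.\<close>

lemma rule_realizes:
  assumes "rule L X \<alpha> \<phi> As" and X: "realizes L K I X"
  shows "\<exists>A\<in>As. \<exists>I'. realizes L K I' (X \<union> A)"
  using assms(1)
proof cases
  case (atom p)
  then have "realizes_item L K I (Lab \<alpha> (Atom p))"
    using X by (auto simp: realizes_def)
  then obtain i where "i \<in> \<alpha>" "realizes_item L K I (Lab {i} (Atom p))"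
    by auto
  then show ?thesis
    using X atom by (intro bexI[of _ "{Lab {i} (Atom p)}"] exI[of _ I]) auto
next
  case (natom p)
  then have "realizes_item L K I (Lab \<alpha> (NAtom p))"
    using X by (auto simp: realizes_def)
  then obtain i where "i \<in> \<alpha>" "realizes_item L K I (Lab {i} (NAtom p))"
    by auto
  then show ?thesis
    using X natom by (intro bexI[of _ "{Lab {i} (NAtom p)}"] exI[of _ I]) auto
next
  case (conj \<psi> \<chi>)
  then have "realizes_item L K I (Lab \<alpha> (And \<psi> \<chi>))"
    using X by (auto simp: realizes_def)
  then have "realizes L K I {Lab \<alpha> \<psi>} \<or> realizes L K I {Lab \<alpha> \<chi>}"
    by auto
  then show ?thesis
    using X conj by auto
next
  case (disj \<psi> \<chi> \<beta>)
  then have "realizes_item L K I (Lab \<alpha> (Or \<psi> \<chi>))"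
    using X by (auto simp: realizes_def)
  moreover have "I ` \<alpha> = I ` \<beta> \<union> I ` (\<alpha> - \<beta>)"
    using disj by blast
  ultimately have "realizes L K I {Lab \<beta> \<psi>} \<or> realizes L K I {Lab (\<alpha> - \<beta>) \<chi>}"
    by auto
  then show ?thesis
    using X disj by auto
next
  case (dia \<psi> s)
  have lab: "formula_of L \<psi>" "\<not> sat K (I ` \<alpha>) (Dia \<psi>)"
    using X dia by (auto simp: realizes_def simp del: sat.simps)
  have "\<forall>i\<in>\<alpha>. (I i, I (s i)) \<in> rel K"
    using X dia by (force simp: realizes_def)
  \<comment> \<open>The names chosen by \<open>s\<close> form an admissible successor team, on which
    a falsified diamond forces \<open>\<psi>\<close> to fail.\<close>
  then have "\<not> sat K (I ` s ` \<alpha>) \<psi>"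
    using lab(2) by (auto dest!: spec[of _ "I ` s ` \<alpha>"])
  then show ?thesis
    using X dia lab(1) by auto
next
  case (box \<psi> t j)
  let ?J = "j ` {1..t}"
  have lab: "formula_of L \<psi>" "\<not> sat K (rel K `` (I ` \<alpha>)) \<psi>"
    using X box by (auto simp: realizes_def)
  have "card ?J = 2 ^ vrank \<psi>"
    using box by (simp add: card_image)
  then obtain h where h: "h ` ?J \<subseteq> rel K `` (I ` \<alpha>)" "\<not> sat K (h ` ?J) \<psi>"
    using falsifying_subteam[OF lab] by metis
  \<comment> \<open>Each world picked by \<open>h\<close> has a predecessor named in
    \<open>\<alpha>\<close>; these predecessors determine the alternative \<open>f\<close>.\<close>
  have "\<forall>m\<in>{1..t}. \<exists>i\<in>\<alpha>. (I i, h (j m)) \<in> rel K"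
    using h(1) by blast
  then obtain f where f: "\<forall>m\<in>{1..t}. f m \<in> \<alpha> \<and> (I (f m), h (j m)) \<in> rel K"
    by metis
  define I' where "I' i = (if i \<in> ?J then h i else I i)" for i
  have fresh: "\<forall>i\<in>item_indices x. I i = I' i" if "x \<in> X" for x
    using box that by (auto simp: I'_def)
  have "realizes_item L K I' x" if "x \<in> X" for x
    using X that realizes_item_cong[OF fresh[OF that]] by (auto simp: realizes_def)
  then have X': "realizes L K I' X"
    by (simp add: realizes_def)
  \<comment> \<open>The premise lies in \<open>X\<close>, so the fresh names avoid
    \<open>\<alpha>\<close> and the predecessors keep their worlds under \<open>I'\<close>.\<close>
  have "\<alpha> \<inter> ?J = {}"
    using box by fastforce
  have I_f: "I' (f m) = I (f m)" if "m \<in> {1..t}" for m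
  proof -
    have "f m \<notin> ?J"
      using f that \<open>\<alpha> \<inter> ?J = {}\<close> by blast
    then show ?thesis
      by (simp add: I'_def)
  qed
  have "realizes_item L K I' (Acc (f m) (j m))" if "m \<in> {1..t}" for m
    using f I_f[OF that] that by (simp add: I'_def)
  moreover have "I' ` ?J = h ` ?J"
    by (auto simp: I'_def)
  then have "realizes_item L K I' (Lab ?J \<psi>)"
    using h(2) lab(1) by simp
  ultimately have "realizes L K I' ({Acc (f m) (j m) | m. m \<in> {1..t}} \<union> {Lab ?J \<psi>})"
    by (auto simp: realizes_def)
  moreover have "f ` {1..t} \<subseteq> \<alpha>"
    using f by blast
  ultimately show ?thesis
    using X' unfolding box(2) by (auto simp del: realizes_insert)
next
  case (ior \<psi> \<chi>)
  then have "realizes_item L K I (Lab \<alpha> (IOr \<psi> \<chi>))"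
    using X by (auto simp: realizes_def)
  then show ?thesis
    using X ior by auto
next
  case (split \<phi>s \<psi>)
  then have *: "realizes_item L K I (Lab \<alpha> (Dep \<phi>s \<psi>))"
    using X by (auto simp: realizes_def)
  then obtain a b where ab: "a \<in> \<alpha>" "b \<in> \<alpha>"
      "\<forall>\<chi>\<in>set \<phi>s. sat K {I a} \<chi> \<longleftrightarrow> sat K {I b} \<chi>" "sat K {I a} \<psi> \<longleftrightarrow> \<not> sat K {I b} \<psi>"
    by auto
  \<comment> \<open>Disagreement on \<open>\<psi>\<close> separates the names, so they form a
    2-element label.\<close>
  then have "a \<noteq> b"
    by auto
  then have "{a, b} \<subseteq> \<alpha>" "card {a, b} = 2"
    using ab by auto
  moreover have "\<not> sat K (I ` {a, b}) (Dep \<phi>s \<psi>)"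
    using ab by auto
  then have "realizes L K I {Lab {a, b} (Dep \<phi>s \<psi>)}"
    using * by simp
  ultimately show ?thesis
    using X unfolding split(2) by (intro bexI[of _ "{Lab {a, b} (Dep \<phi>s \<psi>)}"] exI[of _ I]) auto
next
  case (pl_dep i1 i2 ps q)
  then have "formula_of L (Dep (map Atom ps) (Atom q))" "\<not> sat K (I ` {i1, i2}) (Dep (map Atom ps) (Atom q))"
    using X by (auto simp: realizes_def simp del: sat.simps formula_of.simps)
  from realizes_dep_alternative[OF this] show ?thesis
    using X pl_dep(3) by auto
next
  case (ml_dep i1 i2 \<phi>s \<psi>)
  then have "formula_of L (Dep \<phi>s \<psi>)" "\<not> sat K (I ` {i1, i2}) (Dep \<phi>s \<psi>)"
    using X by (auto simp: realizes_def simp del: sat.simps formula_of.simps)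
  from realizes_dep_alternative[OF this] show ?thesis
    using X ml_dep(3) by auto
qed

section \<open>From single rules to whole tableaux\<close>

text \<open>The branch follows a realizable alternative at each node; \<open>I\<close> is
  generalized because it may change on the way down.\<close>

lemma expands_realizes:
  "expands L B D t \<Longrightarrow> realizes L K I (B \<union> items t) \<Longrightarrow>
     \<exists>b\<in>branches t. \<exists>I'. realizes L K I' (B \<union> b)"
proof (induction arbitrary: I rule: expands.induct)
  case (leaf B D N)
  then show ?case by auto
next
  case (step X B N \<alpha> \<phi> As D ts)
  then have "realizes L K I X"
    by simp
  then obtain A I1 where A: "A \<in> As" "realizes L K I1 (X \<union> A)"
    using rule_realizes[OF step.hyps(2)] by metis
  then obtain t where t: "t \<in> set ts" "items t = A - X"
    using step.hyps(4) by (metis (no_types, lifting) imageE imageI)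
  \<comment> \<open>The child omits only items of \<open>X\<close>, which are realized
    already.\<close>
  then have "realizes L K I1 (X \<union> items t)"
    using A(2) by (simp add: realizes_def)
  then obtain b I2 where b: "b \<in> branches t" "realizes L K I2 (X \<union> b)"
    using step.IH t(1) by meson
  then show ?case
    using t(1) step.hyps(1) by (intro bexI[of _ "N \<union> b"] exI[of _ I2]) auto
qed

text \<open>The empty team satisfies every formula of \<open>L\<close>, a single world satisfies a
  literal or its complement, and a one-world team satisfies every dependence atom.\<close>

lemma not_realizes_closed_branch:
  assumes "closed_branch b"
  shows "\<not> realizes L K I b"
  using assms
proof cases
  case (empty \<psi>)
  then show ?thesis
    using sat_empty_team by (fastforce simp: realizes_def)
next
  case (clash i p)
  then have "realizes_item L K I (Lab {i} (Atom p)) \<and> realizes_item L K I (Lab {i} (NAtom p))"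
    if "realizes L K I b"
    using that unfolding realizes_def by blast
  then show ?thesis
    by auto
next
  case (dep i \<phi>s \<psi>)
  then have "realizes_item L K I (Lab {i} (Dep \<phi>s \<psi>))" if "realizes L K I b"
    using that unfolding realizes_def by blast
  then show ?thesis
    by auto
qed

theorem theorem8:
  fixes L :: logic and \<phi> :: "'p fm"
  assumes "formula_of L \<phi>"
    and "\<exists>t. tableau_for L \<phi> t \<and> closed_tableau t"
  shows "valid TYPE('w) \<phi>"
proof -
  have "sat K T \<phi>" for K :: "('w, 'p) kripke" and T
  proof (rule ccontr)
    assume "\<not> sat K T \<phi>"
    \<comment> \<open>The root label plays the role of \<open>J\<close>, so the map onto the
      falsifying subteam is a naming that realizes the root.\<close>
    then obtain I where "\<not> sat K (I ` {1::nat..2 ^ vrank \<phi>}) \<phi>"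
      using falsifying_subteam[OF assms(1), of K T "{1::nat..2 ^ vrank \<phi>}"] by auto
    moreover obtain t where "tableau_for L \<phi> t" "closed_tableau t"
      using assms(2) by blast
    ultimately show False
      using expands_realizes[of L "{}" "{}" t K I] assms(1) not_realizes_closed_branch[of _ L K]
      by (auto simp: tableau_for_def closed_tableau_def)
  qed
  then show ?thesis
    by (simp add: valid_def)
qed

end
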